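(* Let $G$ be a block graph (a connected graph all of whose blocks are cliques) of order $p$. Let $\omega = |V(C_D(G))|$ be the number of detour central vertices of $G$, let $\mathcal{L}(G)=\sum_{u\in V(G)}\mathcal{L}(u)$ be the total detour level of $G$, and let $\xi = \min\{|V(B)|-1 : B \text{ is a block of } G \text{ containing the detour central vertex}\}$ if $\omega = 1$, and $\xi = 0$ if $\omega \ge 2$. Then $$hc(G) \ge (p-1)(p-\omega) - 2\mathcal{L}(G) + \xi .$$
   Context: For vertices $u,v$ of a connected graph $G$, the detour distance $D(u,v)$ is the length of a longest $u$–$v$ path in $G$. The detour eccentricity of $v$ is $\max_{x\in V(G)} D(v,x)$; the detour center $C_D(G)$ is the subgraph induced by the vertices of minimum detour eccentricity (the detour central vertices). The detour level of a vertex $u$ is $\mathcal{L}(u)=\min\{D(w,u): w \text{ a detour central vertex}\}$. A hamiltonian coloring of a graph $G$ of order $p$ is a map $c:V(G)\to\{0,1,2,\dots\}$ such that $D(u,v)+|c(u)-c(v)|\ge p-1$ for every two distinct vertices $u,v$. Its value $hc(c)$ is the maximum color $\max_{v} c(v)$, and the hamiltonian chromatic number is $hc(G)=\min\{hc(c)\}$ over all hamiltonian colorings $c$ of $G$ (colors start at $0$, so this is one less than the convention where colors are positive integers). *)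

theory Defs
  imports Graph_Theory.Graph_Theory
begin

text \<open>Finite simple graphs are the symmetric digraphs of the locale \<^locale>\<open>graph\<close>; every
  edge is a pair of opposite arcs, so \<^const>\<open>pre_digraph.apath\<close> describes exactly the
  paths of the undirected graph.\<close>

definition detour_dist :: "('a,'b) pre_digraph \<Rightarrow> 'a \<Rightarrow> 'a \<Rightarrow> nat" where
  "detour_dist G u v = Max {length p | p. pre_digraph.apath G u p v}"

definition detour_ecc :: "('a,'b) pre_digraph \<Rightarrow> 'a \<Rightarrow> nat" where
  "detour_ecc G v = Max (detour_dist G v ` verts G)"

definition detour_central :: "('a,'b) pre_digraph \<Rightarrow> 'a \<Rightarrow> bool" where
  "detour_central G v \<longleftrightarrow> v \<in> verts G \<and> (\<forall>x \<in> verts G. detour_ecc G v \<le> detour_ecc G x)"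

definition detour_center :: "('a,'b) pre_digraph \<Rightarrow> ('a,'b) pre_digraph" where
  "detour_center G = G \<restriction> {v. detour_central G v}"

definition detour_level :: "('a,'b) pre_digraph \<Rightarrow> 'a \<Rightarrow> nat" where
  "detour_level G u = Min {detour_dist G w u | w. detour_central G w}"

definition total_detour_level :: "('a,'b) pre_digraph \<Rightarrow> nat" where
  "total_detour_level G = (\<Sum>u \<in> verts G. detour_level G u)"

text \<open>Only meaningful for connected \<open>G\<close>. The null graph is not \<^const>\<open>connected\<close>, so the
  condition \<open>verts G \<noteq> {v}\<close> keeps the vertex of \<open>K\<^sub>1\<close> from being a cut vertex.\<close>

definition cut_vertex :: "('a,'b) pre_digraph \<Rightarrow> 'a \<Rightarrow> bool" where
  "cut_vertex G v \<longleftrightarrow>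
     v \<in> verts G \<and> verts G \<noteq> {v} \<and> \<not> connected (pre_digraph.del_vert G v)"

text \<open>The condition \<^term>\<open>graph H\<close> restricts the subgraphs to symmetric ones, i.e. to subgraphs
  of the undirected graph. Single edges qualify as blocks, and the single vertex of \<open>K\<^sub>1\<close> is
  a block of \<open>K\<^sub>1\<close>.\<close>

definition is_block :: "('a,'b) pre_digraph \<Rightarrow> ('a,'b) pre_digraph \<Rightarrow> bool" where
  "is_block G B \<longleftrightarrow>
     pre_digraph.max_subgraph G (\<lambda>H. graph H \<and> connected H \<and> (\<forall>v. \<not> cut_vertex H v)) B"

definition block_graph :: "('a,'b) pre_digraph \<Rightarrow> bool" where
  "block_graph G \<longleftrightarrow> graph G \<and> connected G
     \<and> (\<forall>B. is_block G B \<longrightarrow> complete_digraph (card (verts B)) B)"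


definition hamiltonian_coloring :: "('a,'b) pre_digraph \<Rightarrow> ('a \<Rightarrow> nat) \<Rightarrow> bool" where
  "hamiltonian_coloring G c \<longleftrightarrow>
     (\<forall>u \<in> verts G. \<forall>v \<in> verts G. u \<noteq> v \<longrightarrow>
        int (detour_dist G u v) + \<bar>int (c u) - int (c v)\<bar> \<ge> int (card (verts G)) - 1)"

definition coloring_value :: "('a,'b) pre_digraph \<Rightarrow> ('a \<Rightarrow> nat) \<Rightarrow> nat" where
  "coloring_value G c = Max (c ` verts G)"

definition ham_chromatic_number :: "('a,'b) pre_digraph \<Rightarrow> nat" where
  "ham_chromatic_number G = Inf (coloring_value G ` {c. hamiltonian_coloring G c})"

text \<open>The infimum is attained, hence a minimum.\<close>

lemma hamiltonian_coloring_exists: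
  assumes "graph G"
  shows "\<exists>c. hamiltonian_coloring G c"
proof -
  interpret graph G by fact
  obtain f :: "'a \<Rightarrow> nat" and n where f: "inj_on f (verts G)"
    using finite_imp_inj_to_nat_seg[OF finite_verts] by blast
  define c where "c v = card (verts G) * f v" for v
  have "hamiltonian_coloring G c"
    unfolding hamiltonian_coloring_def
  proof (intro ballI impI)
    fix u v assume uv: "u \<in> verts G" "v \<in> verts G" "u \<noteq> v"
    then have "f u \<noteq> f v" using f by (auto dest: inj_onD)
    then have "\<bar>int (f u) - int (f v)\<bar> \<ge> 1" by linarith
    then have "int (card (verts G)) * 1 \<le> int (card (verts G)) * \<bar>int (f u) - int (f v)\<bar>"
      by (intro mult_left_mono) auto
    also have "\<dots> = \<bar>int (c u) - int (c v)\<bar>"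
      by (simp add: c_def abs_mult flip: right_diff_distrib)
    finally show "int (detour_dist G u v) + \<bar>int (c u) - int (c v)\<bar> \<ge> int (card (verts G)) - 1"
      by simp
  qed
  then show ?thesis by blast
qed

lemma ham_chromatic_number_attained:
  assumes "graph G"
  shows "\<exists>c. hamiltonian_coloring G c \<and> coloring_value G c = ham_chromatic_number G"
proof -
  have "coloring_value G ` {c. hamiltonian_coloring G c} \<noteq> {}"
    using hamiltonian_coloring_exists[OF assms] by auto
  from Inf_nat_def1[OF this] show ?thesis
    unfolding ham_chromatic_number_def by auto
qed

end

theory Submission
  imports Defs
begin

text \<open>List the vertices as \<open>u\<^sub>1, \<dots>, u\<^sub>p\<close> in the order of their colors. Consecutive colors
  differ by at least \<open>p - 1 - D(u\<^sub>i, u\<^sub>i\<^sub>+\<^sub>1)\<close>, and \<open>D(u, v) \<le> \<L>(u) + \<L>(v) + \<omega> - 1\<close>, because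
  \<open>D\<close> is a metric and, in a block graph, a path between two detour central vertices visits only
  detour central vertices. Summing up, every vertex except \<open>u\<^sub>1\<close> and \<open>u\<^sub>p\<close> contributes its level
  twice. If \<open>\<omega> = 1\<close>, one of these two is not central, and its level is at least \<open>\<xi>\<close>.

  Apart from the bound by \<open>\<xi>\<close>, the only property of block graphs that is needed is that the
  vertices of a cycle are pairwise adjacent.\<close>

unbundle no funcset_syntax

section \<open>Paths as vertex lists\<close>

context graph begin

lemma vwalk_iff_successively:
  "vwalk xs G \<longleftrightarrow> xs \<noteq> [] \<and> set xs \<subseteq> verts G \<and> successively (\<lambda>u v. u \<rightarrow> v) xs"
  by (induction xs rule: vwalk_arcs.induct) (auto simp: vwalk_def)

lemma vpath_iff_successively:
  "vpath xs G \<longleftrightarrow>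
     xs \<noteq> [] \<and> distinct xs \<and> set xs \<subseteq> verts G \<and> successively (\<lambda>u v. u \<rightarrow> v) xs"
  by (auto simp: vpath_def vwalk_iff_successively)

lemma adj_sym: "u \<rightarrow> v \<longleftrightarrow> v \<rightarrow> u"
  using graph_symmetric by blast

lemma vpath_rev: "vpath (rev xs) G \<longleftrightarrow> vpath xs G"
  using adj_sym by (simp add: vpath_iff_successively)

lemma vpath_append_iff:
  assumes "xs \<noteq> []" "ys \<noteq> []"
  shows "vpath (xs @ ys) G \<longleftrightarrow>
    vpath xs G \<and> vpath ys G \<and> set xs \<inter> set ys = {} \<and> last xs \<rightarrow> hd ys"
  using assms by (auto simp: vpath_iff_successively successively_append_iff)

lemma vpath_Cons_iff:
  assumes "ys \<noteq> []"
  shows "vpath (x # ys) G \<longleftrightarrow> vpath ys G \<and> x \<notin> set ys \<and> x \<rightarrow> hd ys"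
  using assms adj_in_verts by (auto simp: vpath_iff_successively successively_Cons)

lemma vpath_prefix: "vpath (xs @ ys) G \<Longrightarrow> xs \<noteq> [] \<Longrightarrow> vpath xs G"
  by (auto simp: vpath_iff_successively successively_append_iff)

lemma vpath_suffix: "vpath (xs @ ys) G \<Longrightarrow> ys \<noteq> [] \<Longrightarrow> vpath ys G"
  by (auto simp: vpath_iff_successively successively_append_iff)

lemma vpath_of_clique:
  assumes "distinct xs" "xs \<noteq> []" "set xs \<subseteq> K" "K \<subseteq> verts G"
    and "\<And>u v. u \<in> K \<Longrightarrow> v \<in> K \<Longrightarrow> u \<noteq> v \<Longrightarrow> u \<rightarrow> v"
  shows "vpath xs G"
  using assms(1-3)
proof (induction xs)
  case (Cons x xs)
  then show ?case using assms(4,5) by (cases xs) (auto simp: vpath_iff_successively)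
qed simp

section \<open>Connectivity of subgraphs induced by paths\<close>

lemma reachable_in_vpath:
  assumes "vpath xs G" "set xs \<subseteq> S" "u \<in> set xs" "v \<in> set xs"
  shows "u \<rightarrow>\<^sup>*\<^bsub>G \<restriction> S\<^esub> v"
proof -
  interpret H: wf_digraph "G \<restriction> S" ..
  have adj: "a \<rightarrow>\<^bsub>G \<restriction> S\<^esub> b" if "a \<rightarrow> b" "a \<in> S" "b \<in> S" for a b
    using that by (auto simp: arcs_ends_conv)
  \<comment> \<open>Every vertex of the list is linked with the head in both directions;
    \<open>u\<close> and \<open>v\<close> are then joined through the head.\<close>
  have *: "hd xs \<rightarrow>\<^sup>*\<^bsub>G \<restriction> S\<^esub> w \<and> w \<rightarrow>\<^sup>*\<^bsub>G \<restriction> S\<^esub> hd xs"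
    if "successively (\<lambda>u v. u \<rightarrow> v) xs" "set xs \<subseteq> S" "w \<in> set xs" for xs w
    using that
  proof (induction xs)
    case (Cons x xs)
    show ?case
    proof (cases "w = x")
      case True
      then show ?thesis using Cons.prems by simp
    next
      case False
      then have *: "xs \<noteq> []" "x \<rightarrow> hd xs" "hd xs \<rightarrow>\<^sup>*\<^bsub>G \<restriction> S\<^esub> w" "w \<rightarrow>\<^sup>*\<^bsub>G \<restriction> S\<^esub> hd xs"
        using Cons by (auto simp: successively_Cons)
      moreover from *(1) have "hd xs \<in> S" using Cons.prems by auto
      ultimately have "x \<rightarrow>\<^bsub>G \<restriction> S\<^esub> hd xs" "hd xs \<rightarrow>\<^bsub>G \<restriction> S\<^esub> x"
        using Cons.prems adj adj_sym by auto
      then show ?thesis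
        using H.adj_reachable_trans[OF _ *(3)] H.reachable_adj_trans[OF *(4)] by simp
    qed
  qed simp
  show ?thesis
    using *[of xs u] *[of xs v] assms H.reachable_trans[of u "hd xs" v]
    by (simp add: vpath_iff_successively)
qed

lemma graph_induce:
  assumes "S \<subseteq> verts G"
  shows "graph (G \<restriction> S)"
proof -
  note ind = induced_induce[OF assms]
  interpret H: digraph "G \<restriction> S" using digraphI_induced[OF ind] .
  interpret H: sym_digraph "G \<restriction> S" using induced_graph_imp_graph[OF ind] .
  show ?thesis by unfold_locales
qed

lemma connected_induce_vpath:
  assumes "vpath xs G"
  shows "connected (G \<restriction> set xs)"
proof -
  have S: "set xs \<subseteq> verts G" and ne: "xs \<noteq> []"
    using assms by (auto simp: vpath_iff_successively)
  interpret H: graph "G \<restriction> set xs" using graph_induce[OF S] .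
  show ?thesis
    unfolding connected_def strongly_connected_def
    using ne reachable_in_vpath[OF assms] H.reachable_mk_symmetricI by auto
qed

section \<open>Longest paths in terms of vertex lists\<close>

lemma awalk_of_vwalk:
  assumes "vwalk xs G"
  shows "\<exists>p. awalk (hd xs) p (last xs) \<and> awalk_verts (hd xs) p = xs"
  using assms
proof (induction rule: vwalk_induct)
  case (Base u)
  then show ?case by (intro exI[of _ "[]"]) (auto simp: awalk_simps)
next
  case (Cons u v es)
  then obtain p where p: "awalk v p (last (v # es))" "awalk_verts v p = v # es" by auto
  obtain e where "e \<in> arcs G" "tail G e = u" "head G e = v"
    using Cons.hyps by (auto simp: arcs_ends_conv)
  with p show ?case by (intro exI[of _ "e # p"]) (auto simp: awalk_simps)
qed

text \<open>Makes \<open>detour_dist\<close>, which counts arcs, computable from vertex lists; a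
  path has one vertex more than arcs.\<close>

lemma apath_lengths:
  "{length p | p. apath u p v} = {length xs - 1 | xs. vpath xs G \<and> hd xs = u \<and> last xs = v}"
proof (intro equalityI subsetI)
  fix n assume "n \<in> {length p | p. apath u p v}"
  then obtain p where p: "n = length p" "awalk u p v" "distinct (awalk_verts u p)"
    by (auto simp: apath_def)
  then have "vpath (awalk_verts u p) G" "hd (awalk_verts u p) = u" "last (awalk_verts u p) = v"
    using awalk_imp_vwalk awalk_ends by auto
  then show "n \<in> {length xs - 1 | xs. vpath xs G \<and> hd xs = u \<and> last xs = v}"
    using p length_awalk_verts[of u p] by (intro CollectI exI[of _ "awalk_verts u p"]) auto
next
  fix n assume "n \<in> {length xs - 1 | xs. vpath xs G \<and> hd xs = u \<and> last xs = v}"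
  then obtain xs where xs: "n = length xs - 1" "vpath xs G" "hd xs = u" "last xs = v" by auto
  then obtain p where "awalk u p v" "awalk_verts u p = xs"
    using awalk_of_vwalk[of xs] by (auto simp: vpath_def)
  then show "n \<in> {length p | p. apath u p v}"
    using xs length_awalk_verts[of u p] by (intro CollectI exI[of _ p]) (auto simp: apath_def vpath_def)
qed

lemma vpath_length_le:
  assumes "vpath xs G"
  shows "length xs \<le> card (verts G)"
proof -
  have "card (set xs) \<le> card (verts G)"
    using assms by (intro card_mono) (simp_all add: vpath_iff_successively)
  then show ?thesis using assms distinct_card[of xs] by (simp add: vpath_iff_successively)
qed

lemma finite_apath_lengths: "finite {length p | p. apath u p v}"
proof (rule finite_subset)
  show "{length p | p. apath u p v} \<subseteq> {..card (verts G)}"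
    unfolding apath_lengths using vpath_length_le by force
qed simp

lemma length_le_detour_dist:
  assumes "vpath xs G" "hd xs = u" "last xs = v"
  shows "length xs \<le> Suc (detour_dist G u v)"
proof -
  have "length xs - 1 \<in> {length p | p. apath u p v}"
    unfolding apath_lengths using assms by blast
  then have "length xs - 1 \<le> detour_dist G u v"
    unfolding detour_dist_def by (rule Max_ge[OF finite_apath_lengths])
  then show ?thesis by simp
qed

end

lemma hd_last_distinct:
  "distinct xs \<Longrightarrow> xs \<noteq> [] \<Longrightarrow> hd xs = last xs \<Longrightarrow> length xs = 1"
  by (cases xs) (auto split: if_splits)

section \<open>The detour metric of a connected graph\<close>

locale connected_graph = graph +
  assumes conn: "connected G"
begin

lemma reachable_all: "u \<in> verts G \<Longrightarrow> v \<in> verts G \<Longrightarrow> u \<rightarrow>\<^sup>* v"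
  using symmetric_connected_imp_strongly_connected[OF sym_arcs conn]
  by (simp add: strongly_connected_def)

lemma verts_nonempty: "verts G \<noteq> {}"
  using conn by (auto simp: connected_conv)

lemma detour_path_exists:
  assumes "u \<in> verts G" "v \<in> verts G"
  obtains xs where "vpath xs G" "hd xs = u" "last xs = v" "length xs = Suc (detour_dist G u v)"
proof -
  obtain ys where "vpath ys G" "hd ys = u" "last ys = v"
    using reachable_all[OF assms] by (auto simp: reachable_vpath_conv)
  then have "{length p | p. apath u p v} \<noteq> {}"
    unfolding apath_lengths by blast
  then have "detour_dist G u v \<in> {length p | p. apath u p v}"
    unfolding detour_dist_def by (rule Max_in[OF finite_apath_lengths])
  then obtain xs where "vpath xs G" "hd xs = u" "last xs = v" "detour_dist G u v = length xs - 1"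
    unfolding apath_lengths by auto
  then show ?thesis by (intro that[of xs]) (auto simp: vpath_iff_successively)
qed

lemma detour_dist_commute_le:
  assumes "u \<in> verts G" "v \<in> verts G"
  shows "detour_dist G v u \<le> detour_dist G u v"
proof -
  obtain xs where xs: "vpath xs G" "hd xs = v" "last xs = u" "length xs = Suc (detour_dist G v u)"
    using detour_path_exists assms by metis
  then have "length (rev xs) \<le> Suc (detour_dist G u v)"
    by (intro length_le_detour_dist) (auto simp: vpath_rev hd_rev last_rev)
  then show ?thesis using xs by simp
qed

lemma detour_dist_commute:
  "u \<in> verts G \<Longrightarrow> v \<in> verts G \<Longrightarrow> detour_dist G u v = detour_dist G v u"
  by (intro antisym detour_dist_commute_le)

text \<open>Cut a longest path from \<open>u\<close> to \<open>v\<close> where a path starting in \<open>w\<close> first hits it.\<close>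

lemma detour_dist_triangle:
  assumes "u \<in> verts G" "v \<in> verts G" "w \<in> verts G"
  shows "detour_dist G u v \<le> detour_dist G u w + detour_dist G w v"
proof -
  obtain P where P: "vpath P G" "hd P = u" "last P = v" "length P = Suc (detour_dist G u v)"
    using detour_path_exists assms by metis
  obtain R where R: "vpath R G" "hd R = w" "last R = u"
    using detour_path_exists assms by metis
  have "P \<noteq> []" "R \<noteq> []" using P R by (auto simp: vpath_iff_successively)
  then have "\<exists>t\<in>set R. t \<in> set P" using P R by (metis hd_in_set last_in_set)
  \<comment> \<open>Taking the first hit \<open>t\<close> keeps \<open>R1\<close> disjoint from
    \<open>P\<close>, so from \<open>t\<close> the path can continue along \<open>P\<close> forwards
    to \<open>v\<close> or backwards to \<open>u\<close>. The two resulting paths together cover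
    both parts of \<open>P\<close>.\<close>
  then obtain R1 t R2 where split: "R = R1 @ t # R2" "t \<in> set P" "\<forall>r\<in>set R1. r \<notin> set P"
    by (rule split_list_first_propE)
  then obtain P1 P2 where P12: "P = P1 @ t # P2" by (meson split_list)
  have Rt: "vpath (R1 @ [t]) G"
    using R(1) split(1) vpath_prefix[of "R1 @ [t]" R2] by auto
  have hdR: "hd (R1 @ [t]) = w" using R split by (cases R1) auto
  have "vpath ((R1 @ [t]) @ P2) G"
  proof (cases "P2 = []")
    case False
    have "vpath (t # P2) G" using P(1) P12 vpath_suffix by blast
    then show ?thesis
      using Rt split(3) False P12 by (subst vpath_append_iff) (auto simp: vpath_Cons_iff)
  qed (use Rt in simp)
  then have 1: "length (R1 @ [t] @ P2) \<le> Suc (detour_dist G w v)"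
    using hdR P P12 by (intro length_le_detour_dist) (auto simp: hd_append split: if_splits)
  have "vpath ((R1 @ [t]) @ rev P1) G"
  proof (cases "P1 = []")
    case False
    have "vpath (P1 @ [t]) G" using P(1) P12 vpath_prefix[of "P1 @ [t]" P2] by simp
    then have "vpath P1 G" "last P1 \<rightarrow> t" "t \<notin> set P1"
      using False by (auto simp: vpath_append_iff)
    then show ?thesis
      using Rt split(3) False P12 adj_sym
      by (subst vpath_append_iff) (auto simp: vpath_rev hd_rev)
  qed (use Rt in simp)
  then have "length (R1 @ [t] @ rev P1) \<le> Suc (detour_dist G w u)"
    using hdR P P12
    by (intro length_le_detour_dist) (auto simp: hd_append last_rev split: if_splits)
  then show ?thesis
    using 1 P(4) P12 detour_dist_commute[OF assms(1,3)] by simp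
qed

lemma detour_dist_self:
  assumes "v \<in> verts G"
  shows "detour_dist G v v = 0"
proof -
  obtain xs where xs: "vpath xs G" "hd xs = v" "last xs = v" "length xs = Suc (detour_dist G v v)"
    using detour_path_exists[OF assms assms] .
  then have "length xs = 1"
    by (intro hd_last_distinct) (simp_all add: vpath_iff_successively)
  then show ?thesis using xs(4) by simp
qed

section \<open>Detour eccentricity, central vertices and levels\<close>

lemma detour_dist_le_ecc: "y \<in> verts G \<Longrightarrow> detour_dist G v y \<le> detour_ecc G v"
  by (simp add: detour_ecc_def)

lemma length_le_detour_ecc:
  assumes "vpath xs G" "hd xs = v"
  shows "length xs \<le> Suc (detour_ecc G v)"
proof -
  have "last xs \<in> verts G" using assms(1) by (auto simp: vpath_iff_successively)
  then show ?thesis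
    using length_le_detour_dist[OF assms refl] detour_dist_le_ecc[of "last xs" v] by simp
qed

lemma detour_ecc_path:
  assumes "v \<in> verts G"
  obtains Q where "vpath (v # Q) G" "length Q = detour_ecc G v"
proof -
  have "detour_ecc G v \<in> detour_dist G v ` verts G"
    unfolding detour_ecc_def using verts_nonempty by (intro Max_in) auto
  then obtain y where y: "y \<in> verts G" "detour_dist G v y = detour_ecc G v" by auto
  from detour_path_exists[OF assms this(1)] obtain xs
    where "vpath xs G" "hd xs = v" "length xs = Suc (detour_dist G v y)" by metis
  then show ?thesis using that[of "tl xs"] y by (cases xs) auto
qed

lemma detour_central_exists: "\<exists>w. detour_central G w"
proof -
  have "\<exists>w. w \<in> verts G \<and> (\<forall>x. x \<in> verts G \<longrightarrow> detour_ecc G w \<le> detour_ecc G x)"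
    using ex_has_least_nat[of "\<lambda>x. x \<in> verts G" _ "detour_ecc G"] verts_nonempty by auto
  then show ?thesis by (auto simp: detour_central_def)
qed

lemma detour_level_attained:
  "\<exists>w. detour_central G w \<and> detour_dist G w u = detour_level G u"
proof -
  have "finite {w. detour_central G w}"
    by (rule finite_subset[of _ "verts G"]) (auto simp: detour_central_def)
  then have "detour_level G u \<in> {detour_dist G w u | w. detour_central G w}"
    unfolding detour_level_def using detour_central_exists by (intro Min_in) auto
  then show ?thesis by auto
qed

text \<open>A longest path \<open>x # Q\<close> starting in the separating vertex \<open>x\<close> cannot visit both sides,
  so it can be prolonged at \<open>x\<close> towards \<open>w\<close> or towards \<open>w'\<close>.\<close>

lemma separated_not_both_central:
  assumes P: "vpath (w # x # T) G" "T \<noteq> []" "last T = w'"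
    and sep: "\<not> w \<rightarrow>\<^sup>*\<^bsub>G \<restriction> (verts G - {x})\<^esub> w'"
  shows "\<not> (detour_central G w \<and> detour_central G w')"
proof
  let ?S = "verts G - {x}"
  assume central: "detour_central G w \<and> detour_central G w'"
  interpret H: wf_digraph "G \<restriction> ?S" ..
  have PT: "vpath T G" "x \<notin> set T" "w \<notin> set T" "w \<noteq> x" "w \<rightarrow> x" "x \<rightarrow> hd T"
    using P by (auto simp: vpath_Cons_iff)
  have x: "x \<in> verts G" using P(1) by (auto simp: vpath_iff_successively)
  then obtain Q where Q: "vpath (x # Q) G" "length Q = detour_ecc G x"
    using detour_ecc_path by blast
  have ecc: "detour_ecc G w \<le> detour_ecc G x" "detour_ecc G w' \<le> detour_ecc G x"
    using central x by (auto simp: detour_central_def)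
  \<comment> \<open>Otherwise \<open>w # x # Q\<close> is a path from \<open>w\<close> with more
    than \<open>detour_ecc G x\<close> arcs, although \<open>w\<close> is central.\<close>
  have wQ: "w \<in> set Q"
  proof (rule ccontr)
    assume "w \<notin> set Q"
    then have "vpath (w # x # Q) G" using Q(1) PT by (simp add: vpath_Cons_iff)
    then show False using length_le_detour_ecc[of "w # x # Q" w] ecc Q(2) by simp
  qed
  then have "Q \<noteq> []" by auto
  then have vQ: "vpath Q G" "x \<notin> set Q" using Q(1) by (auto simp: vpath_Cons_iff)
  \<comment> \<open>Otherwise the reversed \<open>T\<close> prolongs \<open>x # Q\<close> to a path
    starting in \<open>w'\<close>, against the centrality of \<open>w'\<close>.\<close>
  have "set Q \<inter> set T \<noteq> {}"
  proof
    assume "set Q \<inter> set T = {}"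
    then have "vpath (rev T @ x # Q) G"
      using Q(1) PT P(2) adj_sym by (subst vpath_append_iff) (auto simp: vpath_rev last_rev)
    then show False
      using length_le_detour_ecc[of "rev T @ x # Q" w'] ecc Q(2) P(2,3)
      by (cases T rule: rev_cases) auto
  qed
  then obtain t where t: "t \<in> set Q" "t \<in> set T" by auto
  \<comment> \<open>\<open>Q\<close> joins \<open>w\<close> to \<open>t\<close> and \<open>T\<close>
    joins \<open>t\<close> to \<open>w'\<close>, both avoiding \<open>x\<close>.\<close>
  have "set Q \<subseteq> ?S" "set T \<subseteq> ?S" using vQ PT by (auto simp: vpath_iff_successively)
  then have "w \<rightarrow>\<^sup>*\<^bsub>G \<restriction> ?S\<^esub> t" "t \<rightarrow>\<^sup>*\<^bsub>G \<restriction> ?S\<^esub> w'"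
    using reachable_in_vpath[OF vQ(1), of ?S w t] reachable_in_vpath[OF PT(1), of ?S t w']
      wQ t P by auto
  then show False using sep H.reachable_trans by blast
qed

end

section \<open>Blocks\<close>

context graph begin

text \<open>By finiteness there is a nonseparable subgraph above \<open>G \<restriction> S\<close>
  of largest size; it is maximal and hence a block.\<close>

lemma nonseparable_in_block:
  assumes S: "S \<subseteq> verts G" "connected (G \<restriction> S)"
    and nonsep: "\<And>v. v \<in> S \<Longrightarrow> S \<noteq> {v} \<Longrightarrow> connected (G \<restriction> (S - {v}))"
  obtains B where "is_block G B" "S \<subseteq> verts B"
proof -
  define P where "P = (\<lambda>H :: ('a,'b) pre_digraph.
    graph H \<and> connected H \<and> (\<forall>v. \<not> cut_vertex H v))"
  define C where "C H \<longleftrightarrow> subgraph (G \<restriction> S) H \<and> subgraph H G \<and> P H" for H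
  \<comment> \<open>Blocks are maximal among all subgraphs, not just induced ones, so the size
    counts arcs as well as vertices.\<close>
  define m where "m H = card (verts H) + card (arcs H)" for H :: "('a,'b) pre_digraph"
  have "pre_digraph.del_vert (G \<restriction> S) v = G \<restriction> (S - {v})" for v
    by (auto simp: pre_digraph.del_vert_def induce_subgraph_def)
  then have "P (G \<restriction> S)"
    using graph_induce[OF S(1)] S(2) nonsep by (auto simp: P_def cut_vertex_def)
  moreover have subS: "subgraph (G \<restriction> S) G" using subgraph_induce_subgraphI S(1) .
  ultimately have "C (G \<restriction> S)"
    unfolding C_def using wf_digraph.subgraph_refl[OF wellformed_induce_subgraph] by blast
  moreover have "m H < Suc (card (verts G) + card (arcs G))" if "C H" for H
    using that by (auto simp: C_def m_def subgraph_def less_Suc_eq_le intro!: add_mono card_mono)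
  ultimately obtain B where B: "C B" "\<And>H. C H \<Longrightarrow> m H \<le> m B"
    using ex_has_greatest_nat[of C "G \<restriction> S" m "Suc (card (verts G) + card (arcs G))"]
    by (metis less_imp_le)
  have "H' = B" if "subgraph B H'" "subgraph H' G" "P H'" for H'
  proof -
    have "C H'" using that B(1) subgraph_trans by (auto simp: C_def)
    then have le: "m H' \<le> m B" using B by blast
    interpret H': graph H' using that(3) by (simp add: P_def)
    have sub: "verts B \<subseteq> verts H'" "arcs B \<subseteq> arcs H'" using that(1) by (auto simp: subgraph_def)
    then have "card (verts B) \<le> card (verts H')" "card (arcs B) \<le> card (arcs H')"
      by (auto intro: card_mono)
    with le have "card (verts H') \<le> card (verts B)" "card (arcs H') \<le> card (arcs B)"
      by (auto simp: m_def)
    then have "verts B = verts H'" "arcs B = arcs H'"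
      using card_seteq[OF H'.finite_verts sub(1)] card_seteq[OF H'.finite_arcs sub(2)] by auto
    then show ?thesis
      using that(1) by (auto simp: subgraph_def compatible_def intro: pre_digraph.equality)
  qed
  then have "is_block G B"
    using B(1) unfolding is_block_def pre_digraph.max_subgraph_def C_def P_def by blast
  moreover have "S \<subseteq> verts B" using B(1) by (auto simp: C_def subgraph_def)
  ultimately show ?thesis using that by blast
qed

text \<open>Deleting \<open>v\<close> from the cycle \<open>ys @ v # zs\<close> leaves the path
  \<open>zs @ ys\<close>, glued by the closing edge if both parts are nonempty, so no vertex
  separates. A single edge counts as a cycle here, and \<open>length xs = 1\<close> admits a single
  vertex.\<close>

lemma cycle_in_block:
  assumes xs: "vpath xs G" and closed: "hd xs \<rightarrow> last xs \<or> length xs = 1"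
  obtains B where "is_block G B" "set xs \<subseteq> verts B"
proof (rule nonseparable_in_block)
  show "set xs \<subseteq> verts G" using xs by (auto simp: vpath_iff_successively)
  show "connected (G \<restriction> set xs)" using connected_induce_vpath xs .
  fix v assume "v \<in> set xs" "set xs \<noteq> {v}"
  then obtain ys zs where split: "xs = ys @ v # zs" by (meson split_list)
  then have ne: "ys \<noteq> [] \<or> zs \<noteq> []" using \<open>set xs \<noteq> {v}\<close> by auto
  have v: "v \<notin> set ys" "v \<notin> set zs" using xs split by (auto simp: vpath_iff_successively)
  have "vpath (zs @ ys) G"
  proof (cases "ys = [] \<or> zs = []")
    case True
    then show ?thesis
      using ne xs split vpath_prefix[of ys "v # zs"] vpath_suffix[of "[v]" zs] by auto
  next
    case False
    then have "last zs \<rightarrow> hd ys" using closed split adj_sym by auto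
    moreover have "vpath ys G" "vpath zs G" "set zs \<inter> set ys = {}"
      using xs split False by (auto simp: vpath_append_iff vpath_Cons_iff)
    ultimately show ?thesis using False by (simp add: vpath_append_iff)
  qed
  moreover have "set xs - {v} = set (zs @ ys)" using split v by auto
  ultimately show "connected (G \<restriction> (set xs - {v}))" using connected_induce_vpath by metis
qed (use that in blast)

end

section \<open>Block graphs\<close>

locale clique_block_graph = connected_graph +
  assumes block_complete: "is_block G B \<Longrightarrow> complete_digraph (card (verts B)) B"
begin

lemma block_verts: "is_block G B \<Longrightarrow> verts B \<subseteq> verts G"
  by (auto simp: is_block_def pre_digraph.max_subgraph_def subgraph_def)

lemma block_clique:
  assumes "is_block G B" "u \<in> verts B" "v \<in> verts B" "u \<noteq> v"
  shows "u \<rightarrow> v"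
proof -
  have "u \<rightarrow>\<^bsub>B\<^esub> v"
    using block_complete[OF assms(1)] assms(2-4) by (auto simp: complete_digraph_def)
  moreover have "subgraph B G"
    using assms(1) by (simp add: is_block_def pre_digraph.max_subgraph_def)
  ultimately show ?thesis by (rule adj_mono)
qed

text \<open>The cycle lies inside one block, which is complete. The chords that reroute paths in the
  study of the detour center come from here.\<close>

lemma cycle_clique:
  assumes "vpath xs G" "hd xs \<rightarrow> last xs" "u \<in> set xs" "v \<in> set xs" "u \<noteq> v"
  shows "u \<rightarrow> v"
proof -
  obtain B where "is_block G B" "set xs \<subseteq> verts B"
    using cycle_in_block[of xs] assms(1,2) by blast
  then show ?thesis using block_clique[of B u v] assms(3-5) by blast
qed

section \<open>The detour center\<close>

text \<open>If \<open>w\<close> and \<open>w'\<close> are not adjacent, the second vertex of a shortest path between them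
  separates them, since otherwise a cycle would provide a chord shortening the path.\<close>

lemma central_adjacent:
  assumes central: "detour_central G w" "detour_central G w'" and "w \<noteq> w'"
  shows "w \<rightarrow> w'"
proof (rule ccontr)
  assume nadj: "\<not> w \<rightarrow> w'"
  have W: "w \<in> verts G" "w' \<in> verts G" using central by (auto simp: detour_central_def)
  define C where "C P \<longleftrightarrow> vpath P G \<and> hd P = w \<and> last P = w'" for P
  have "\<exists>P. C P" using detour_path_exists[OF W] unfolding C_def by metis
  then obtain P where P: "C P" and least: "\<And>R. C R \<Longrightarrow> length P \<le> length R"
    using ex_has_least_nat[of C _ length] by metis
  have "P \<noteq> []" using P by (auto simp: C_def vpath_iff_successively)
  moreover have "P \<noteq> [w]" using P \<open>w \<noteq> w'\<close> by (metis C_def last_ConsL)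
  moreover have "P \<noteq> [w, x]" for x
  proof
    assume "P = [w, x]"
    then show False using P nadj by (auto simp: C_def vpath_iff_successively)
  qed
  ultimately obtain x T where PT: "P = w # x # T" "T \<noteq> []"
    using P by (cases P; cases "tl P"; auto simp: C_def)
  have T: "vpath (w # x # T) G" "last T = w'" using P PT by (auto simp: C_def)
  interpret H: graph "G \<restriction> (verts G - {x})" by (rule graph_induce) auto
  have "w \<rightarrow>\<^sup>*\<^bsub>G \<restriction> (verts G - {x})\<^esub> w'"
    using separated_not_both_central[OF T(1) PT(2) T(2)] central by blast
  then obtain R where RH: "vpath R (G \<restriction> (verts G - {x}))" and R: "hd R = w" "last R = w'"
    using H.reachable_vpath_conv by auto
  have "vpath R G" "x \<notin> set R"
    using RH dominates_induce_subgraphD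
    by (auto simp: vpath_iff_successively H.vpath_iff_successively elim!: successively_mono)
  have "R \<noteq> []" using RH by (auto simp: H.vpath_iff_successively)
  then have "\<exists>t\<in>set R. t \<in> set T" using R T PT by (metis last_in_set)
  \<comment> \<open>\<open>R\<close> up to \<open>t\<close>, followed by \<open>P\<close> backwards
    from \<open>t\<close> to \<open>x\<close>, closes with the edge between \<open>x\<close> and
    \<open>w\<close> to a cycle through \<open>w\<close> and \<open>t\<close>.\<close>
  then obtain R1 t R2 where split: "R = R1 @ t # R2" "t \<in> set T" "\<forall>r\<in>set R1. r \<notin> set T"
    by (rule split_list_first_propE)
  then obtain T1 T2 where T12: "T = T1 @ t # T2" by (meson split_list)
  have "w \<notin> set T" "w \<noteq> x" "w \<rightarrow> x" using T(1) PT by (auto simp: vpath_Cons_iff)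
  then have "R1 \<noteq> []" using R split by auto
  then have R1: "vpath R1 G" "hd R1 = w" "last R1 \<rightarrow> t"
    using \<open>vpath R G\<close> split R by (auto simp: vpath_append_iff)
  have "vpath ([w] @ (x # T1 @ [t]) @ T2) G" using T(1) T12 by simp
  then have "vpath (x # T1 @ [t]) G" using vpath_suffix vpath_prefix by blast
  then have "vpath (rev (x # T1 @ [t])) G" by (simp only: vpath_rev)
  moreover have "set R1 \<inter> set (rev (x # T1 @ [t])) = {}"
    using split \<open>x \<notin> set R\<close> T12 by auto
  ultimately have "vpath (R1 @ rev (x # T1 @ [t])) G"
    using R1 \<open>R1 \<noteq> []\<close> by (simp add: vpath_append_iff)
  moreover have "hd (R1 @ rev (x # T1 @ [t])) = w" "last (R1 @ rev (x # T1 @ [t])) = x"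
    using R1(2) \<open>R1 \<noteq> []\<close> by simp_all
  moreover have "w \<in> set R1" "w \<noteq> t"
    using R1(2) \<open>R1 \<noteq> []\<close> \<open>w \<notin> set T\<close> split(2) hd_in_set[of R1] by auto
  ultimately have "w \<rightarrow> t"
    using \<open>w \<rightarrow> x\<close> cycle_clique[of "R1 @ rev (x # T1 @ [t])" w t] by simp
  moreover have "vpath (t # T2) G"
    using T(1) T12 vpath_suffix[of "w # x # T1" "t # T2"] by simp
  \<comment> \<open>The chord from \<open>w\<close> to \<open>t\<close> bypasses at least
    \<open>x\<close>, so this path is shorter than \<open>P\<close>.\<close>
  ultimately have "C (w # t # T2)"
    using \<open>w \<notin> set T\<close> T T12 by (auto simp: C_def vpath_Cons_iff)
  from least[OF this] show False using PT T12 by simp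
qed

text \<open>The edge from \<open>x\<close> to \<open>w'\<close> closes the initial segment up to
  \<open>w'\<close> to a cycle, so its vertices form a clique. Exchanging \<open>x\<close> and
  \<open>w\<close> inside it gives a path of the same length that starts in \<open>w\<close>;
  \<open>w'\<close> stays in place as the junction to \<open>C\<close>.\<close>

lemma ecc_le_swap:
  assumes Q: "vpath (x # A @ w # B @ w' # C) G" and "x \<rightarrow> w'"
  shows "length (x # A @ w # B @ w' # C) \<le> Suc (detour_ecc G w)"
proof -
  let ?K = "x # A @ w # B @ [w']"
  have K: "vpath ?K G" using Q vpath_prefix[of ?K C] by simp
  then have clique: "u \<rightarrow> v" if "u \<in> set ?K" "v \<in> set ?K" "u \<noteq> v" for u v
    using cycle_clique[of ?K] assms(2) that by auto
  have "vpath (w # A @ x # B @ [w']) G"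
  proof (rule vpath_of_clique[where K = "set ?K"])
    show "set ?K \<subseteq> verts G" using K unfolding vpath_iff_successively by blast
    show "distinct (w # A @ x # B @ [w'])" using K by (auto simp: vpath_iff_successively)
  qed (use clique in auto)
  moreover have "C = [] \<or> vpath C G \<and> w' \<rightarrow> hd C \<and> set ?K \<inter> set C = {}"
    using Q vpath_append_iff[of ?K C] by (cases "C = []") auto
  ultimately have "vpath ((w # A @ x # B @ [w']) @ C) G"
    by (cases "C = []") (simp, subst vpath_append_iff, auto)
  then show ?thesis using length_le_detour_ecc[of "w # A @ x # B @ w' # C" w] by simp
qed

text \<open>Since \<open>w\<close> and \<open>w'\<close> are adjacent, \<open>P\<close> closes to a
  cycle and \<open>x\<close> is adjacent to both. A longest path from \<open>x\<close> visits both,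
  as it could otherwise be prolonged at \<open>x\<close>. Swapping \<open>x\<close> with the one
  visited first shows that the eccentricity of \<open>x\<close> is at most that of a central
  vertex.\<close>

lemma central_between:
  assumes central: "detour_central G w" "detour_central G w'" and "w \<noteq> w'"
    and P: "vpath P G" "hd P = w" "last P = w'" and "x \<in> set P"
  shows "detour_central G x"
proof (cases "x = w \<or> x = w'")
  case True
  then show ?thesis using central by auto
next
  case False
  have "P \<noteq> []" using \<open>x \<in> set P\<close> by auto
  have "w \<rightarrow> w'" using central_adjacent central \<open>w \<noteq> w'\<close> .
  then have adj: "w \<rightarrow> x" "w' \<rightarrow> x" "x \<rightarrow> w" "x \<rightarrow> w'"
    using cycle_clique[OF P(1)] P(2,3) \<open>P \<noteq> []\<close> \<open>x \<in> set P\<close> False hd_in_set[of P] last_in_set[of P]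
    by auto
  have x: "x \<in> verts G" using P \<open>x \<in> set P\<close> by (auto simp: vpath_iff_successively)
  then obtain Q where Q: "vpath (x # Q) G" "length Q = detour_ecc G x"
    using detour_ecc_path by blast
  have le: "detour_ecc G w \<le> detour_ecc G x" "detour_ecc G w' \<le> detour_ecc G x"
    using central x by (auto simp: detour_central_def)
  have mem: "v \<in> set Q" if "v \<rightarrow> x" "v \<noteq> x" "detour_ecc G v \<le> detour_ecc G x" for v
  proof (rule ccontr)
    assume "v \<notin> set Q"
    then have "vpath (v # x # Q) G" using Q(1) that by (simp add: vpath_Cons_iff)
    then show False using length_le_detour_ecc[of "v # x # Q" v] that(3) Q(2) by simp
  qed
  then have "w \<in> set Q" "w' \<in> set Q" using adj le False by auto
  then obtain A R where AR: "Q = A @ w # R" by (meson split_list)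
  have "detour_ecc G x \<le> detour_ecc G w \<or> detour_ecc G x \<le> detour_ecc G w'"
  proof (cases "w' \<in> set R")
    case True
    then obtain B C where "R = B @ w' # C" by (meson split_list)
    then show ?thesis using ecc_le_swap[of x A w B w' C] Q AR adj by simp
  next
    case False
    then have "w' \<in> set A" using \<open>w' \<in> set Q\<close> AR \<open>w \<noteq> w'\<close> by auto
    then obtain B C where "A = B @ w' # C" by (meson split_list)
    then show ?thesis using ecc_le_swap[of x B w' C w R] Q AR adj by simp
  qed
  then show ?thesis using x central by (force simp: detour_central_def)
qed

text \<open>A longest path between two central vertices stays in the center, so it has at most
  \<omega> vertices and at most \<omega> - 1 arcs.\<close>

lemma central_dist_less:
  assumes "detour_central G w" "detour_central G w'"
  shows "detour_dist G w w' < card {v. detour_central G v}"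
proof -
  have fin: "finite {v. detour_central G v}"
    by (rule finite_subset[of _ "verts G"]) (auto simp: detour_central_def)
  have W: "w \<in> verts G" "w' \<in> verts G" using assms by (auto simp: detour_central_def)
  show ?thesis
  proof (cases "w = w'")
    case True
    then show ?thesis using detour_dist_self[OF W(1)] assms fin by (auto simp: card_gt_0_iff)
  next
    case False
    obtain P where P: "vpath P G" "hd P = w" "last P = w'" "length P = Suc (detour_dist G w w')"
      using detour_path_exists W by metis
    then have "set P \<subseteq> {v. detour_central G v}"
      using central_between[OF assms False] by blast
    then have "card (set P) \<le> card {v. detour_central G v}" using fin card_mono by blast
    moreover have "card (set P) = length P"
      using P(1) by (auto simp: vpath_iff_successively distinct_card)
    ultimately show ?thesis using P(4) by simp
  qed
qed

section \<open>Bounds from detour levels and block sizes\<close>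

text \<open>Apply the triangle inequality along \<open>u\<close>, \<open>w\<close>,
  \<open>w'\<close>, \<open>v\<close>, where \<open>w\<close> and \<open>w'\<close> are central
  vertices attaining the levels of \<open>u\<close> and \<open>v\<close>.\<close>

lemma detour_dist_le_levels:
  assumes "u \<in> verts G" "v \<in> verts G"
  shows "detour_dist G u v < detour_level G u + detour_level G v + card {v. detour_central G v}"
proof -
  obtain w where w: "detour_central G w" "detour_dist G w u = detour_level G u"
    using detour_level_attained by metis
  obtain w' where w': "detour_central G w'" "detour_dist G w' v = detour_level G v"
    using detour_level_attained by metis
  have W: "w \<in> verts G" "w' \<in> verts G" using w w' by (auto simp: detour_central_def)
  have "detour_dist G u v \<le> detour_dist G u w + (detour_dist G w w' + detour_dist G w' v)"
    using detour_dist_triangle[OF assms W(1)] detour_dist_triangle[OF W(1) assms(2) W(2)] by simp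
  then show ?thesis
    using central_dist_less[OF w(1) w'(1)] w w' detour_dist_commute[OF assms(1) W(1)] by simp
qed

text \<open>Let \<open>B\<close> be the block of the first edge of a path from \<open>w\<close> to \<open>u\<close>, and replace the part of
  the path up to the last vertex in \<open>B\<close> by a Hamiltonian path of \<open>B\<close>.\<close>

lemma block_size_le_detour_dist:
  assumes "w \<in> verts G" "u \<in> verts G" "u \<noteq> w"
  obtains B where "is_block G B" "w \<in> verts B" "card (verts B) - 1 \<le> detour_dist G w u"
proof -
  obtain P where P: "vpath P G" "hd P = w" "last P = u"
    using detour_path_exists assms by metis
  then obtain x T where PT: "P = w # x # T"
    using assms(3) by (cases P; cases "tl P") (auto simp: vpath_iff_successively)
  then have "w \<rightarrow> x" "vpath [w, x] G" using P(1) vpath_prefix[of "[w,x]" T]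
    by (auto simp: vpath_iff_successively)
  then obtain B where B: "is_block G B" "w \<in> verts B" "x \<in> verts B"
    using cycle_in_block[of "[w, x]"] by auto
  have "\<exists>z\<in>set P. z \<in> verts B" using PT B by auto
  then obtain P1 z P2 where split: "P = P1 @ z # P2" "z \<in> verts B" "\<forall>y\<in>set P2. y \<notin> verts B"
    by (rule split_list_last_propE)
  \<comment> \<open>The second vertex \<open>x\<close> of \<open>P\<close> is in \<open>B\<close>,
    so the last vertex \<open>z\<close> of \<open>P\<close> in \<open>B\<close> is not
    \<open>w\<close>.\<close>
  have "P1 \<noteq> []" using split PT B by auto
  then have "z \<noteq> w" using split(1) PT P(1) by (cases P1) (auto simp: vpath_iff_successively)
  have fin: "finite (verts B)" using finite_subset[OF block_verts[OF B(1)]] by simp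
  then obtain M where M: "set M = verts B - {w, z}" "distinct M"
    using finite_distinct_list[of "verts B - {w, z}"] by auto
  \<comment> \<open>This list visits every vertex of the clique \<open>B\<close> once, and
    \<open>P2\<close> avoids \<open>B\<close>, so the two can be concatenated.\<close>
  have "vpath (w # M @ [z]) G"
    using M B split(2) \<open>z \<noteq> w\<close> block_clique[OF B(1)] block_verts[OF B(1)]
    by (intro vpath_of_clique[where K = "verts B"]) auto
  moreover have "vpath (z # P2) G" using P(1) split(1) vpath_suffix by blast
  ultimately have "vpath ((w # M @ [z]) @ P2) G"
    using M B(2) split(2,3)
    by (cases "P2 = []") (simp, subst vpath_append_iff, auto simp: vpath_Cons_iff)
  then have "length ((w # M @ [z]) @ P2) \<le> Suc (detour_dist G w u)"
    using P(3) split(1) by (intro length_le_detour_dist) auto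
  moreover have "length M = card (verts B) - 2"
    using M B(2) split(2) \<open>z \<noteq> w\<close> fin distinct_card[OF M(2)] by (simp add: card_Diff_subset)
  ultimately show ?thesis using B by (intro that[of B]) auto
qed

text \<open>Covers the graph with one vertex, where no second vertex provides a block through
  \<open>w\<close>.\<close>

lemma vertex_in_block:
  assumes "w \<in> verts G"
  obtains B where "is_block G B" "w \<in> verts B"
proof -
  have "vpath [w] G" using assms by (simp add: vpath_iff_successively)
  then show ?thesis using cycle_in_block[of "[w]"] that by auto
qed

end

section \<open>The lower bound\<close>

text \<open>Summing \<open>step\<close> over consecutive entries subtracts \<open>L\<close> twice
  for inner entries but once for each end, so the ends are added back to the doubled sum. For a
  singleton both sides are 0.\<close>

lemma telescope_sorted:
  fixes c :: "'a \<Rightarrow> nat" and L :: "'a \<Rightarrow> int"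
  assumes "us \<noteq> []" "distinct us" "set us \<subseteq> V" "sorted (map c us)"
    and step: "\<And>u v. u \<in> V \<Longrightarrow> v \<in> V \<Longrightarrow> u \<noteq> v \<Longrightarrow> c u \<le> c v \<Longrightarrow>
       k - L u - L v \<le> int (c v) - int (c u)"
  shows "k * (int (length us) - 1) - 2 * (\<Sum>u\<leftarrow>us. L u) + L (hd us) + L (last us)
    \<le> int (c (last us)) - int (c (hd us))"
  using assms(1-4)
proof (induction us rule: list_nonempty_induct)
  case (cons u us)
  then have "k - L u - L (hd us) \<le> int (c (hd us)) - int (c u)"
    by (intro step) auto
  with cons show ?case by (auto simp: algebra_simps)
qed simp

theorem theorem1:
  fixes G :: "('a,'b) pre_digraph" and p \<omega> \<xi> :: nat
  assumes "block_graph G"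
    and "p = card (verts G)"
    and "\<omega> = card (verts (detour_center G))"
    and "\<omega> = 1 \<Longrightarrow> \<xi> = Min {card (verts B) - 1 | B. is_block G B \<and> verts (detour_center G) \<subseteq> verts B}"
    and "\<omega> \<ge> 2 \<Longrightarrow> \<xi> = 0"
  shows "int (ham_chromatic_number G)
    \<ge> (int p - 1) * (int p - int \<omega>) - 2 * int (total_detour_level G) + int \<xi>"
proof -
  interpret graph G using assms(1) by (simp add: block_graph_def)
  interpret clique_block_graph G
    using assms(1) by unfold_locales (auto simp: block_graph_def)
  have center: "verts (detour_center G) = {v. detour_central G v}"
    by (simp add: detour_center_def)
  then have \<omega>: "\<omega> = card {v. detour_central G v}" using assms(3) by simp
  have "finite {v. detour_central G v}"
    by (rule finite_subset[of _ "verts G"]) (auto simp: detour_central_def)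
  then have "\<omega> \<noteq> 0" using \<omega> detour_central_exists by auto
  obtain c where c: "hamiltonian_coloring G c" "coloring_value G c = ham_chromatic_number G"
    using ham_chromatic_number_attained graph_axioms by blast
  obtain vs where "set vs = verts G" "distinct vs" using finite_distinct_list[OF finite_verts] by auto
  define us where "us = sort_key c vs"
  have us: "set us = verts G" "distinct us" "sorted (map c us)"
    using \<open>set vs = verts G\<close> \<open>distinct vs\<close> by (auto simp: us_def)
  have len: "length us = p" using us distinct_card assms(2) by metis
  have ne: "us \<noteq> []" using us verts_nonempty by auto
  have ends: "hd us \<in> verts G" "last us \<in> verts G"
    using hd_in_set[OF ne] last_in_set[OF ne] us(1) by simp_all
  \<comment> \<open>The 1 subtracted in the coloring condition cancels against the one in the bound
    \<L>(u) + \<L>(v) + \<omega> - 1 for D(u, v), which leaves the constant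
    \<open>p - \<omega>\<close>.\<close>
  have "int p - int \<omega> - int (detour_level G u) - int (detour_level G v) \<le> int (c v) - int (c u)"
    if "u \<in> verts G" "v \<in> verts G" "u \<noteq> v" "c u \<le> c v" for u v
  proof -
    have "int (detour_dist G u v) + \<bar>int (c u) - int (c v)\<bar> \<ge> int p - 1"
      using c(1) that assms(2) unfolding hamiltonian_coloring_def by blast
    then show ?thesis using detour_dist_le_levels[OF that(1,2)] \<omega> that(4) by linarith
  qed
  then have "(int p - int \<omega>) * (int (length us) - 1) - 2 * (\<Sum>u\<leftarrow>us. int (detour_level G u))
      + int (detour_level G (hd us)) + int (detour_level G (last us))
    \<le> int (c (last us)) - int (c (hd us))"
    using us ne by (intro telescope_sorted[where V = "verts G"]) auto
  moreover have "(\<Sum>u\<leftarrow>us. int (detour_level G u)) = int (total_detour_level G)"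
    using us by (simp add: total_detour_level_def sum_list_distinct_conv_sum_set)
  \<comment> \<open>The largest color bounds the telescoped difference, since
    \<open>c (hd us)\<close> is nonnegative.\<close>
  moreover have "c (last us) \<le> ham_chromatic_number G"
    using c(2) ends by (auto simp: coloring_value_def simp flip: c(2))
  moreover have "\<xi> \<le> detour_level G (hd us) + detour_level G (last us)"
  proof (cases "\<omega> = 1")
    case False
    then show ?thesis using assms(5) \<open>\<omega> \<noteq> 0\<close> by simp
  next
    case True
    then obtain w where w: "{v. detour_central G v} = {w}" using \<omega> card_1_singletonE by metis
    then have "w \<in> verts G" by (auto simp: detour_central_def)
    let ?X = "{card (verts B) - 1 | B. is_block G B \<and> verts (detour_center G) \<subseteq> verts B}"
    \<comment> \<open>Finiteness is what makes \<open>Min\<close> a lower bound of the set.\<close>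
    have "?X \<subseteq> {..p}"
    proof clarify
      fix B assume "is_block G B"
      then show "card (verts B) - 1 \<le> p"
        using card_mono[OF finite_verts block_verts, of B] assms(2) by simp
    qed
    then have fin: "finite ?X" using finite_subset by blast
    have \<xi>: "\<xi> \<le> card (verts B) - 1" if "is_block G B" "w \<in> verts B" for B
      using assms(4)[OF True] Min_le[OF fin] that center w by auto
    \<comment> \<open>With \<open>w\<close> as the sole central vertex, the level of
      \<open>u\<close> is its detour distance from \<open>w\<close>, which is bounded below through
      some block at \<open>w\<close>.\<close>
    have level: "\<xi> \<le> detour_level G u" if u: "u \<in> verts G" "u \<noteq> w" for u
    proof -
      have "detour_dist G w u = detour_level G u" using detour_level_attained[of u] w by (auto simp: set_eq_iff)
      then show ?thesis
        using block_size_le_detour_dist[OF \<open>w \<in> verts G\<close> u] \<xi> by (metis le_trans)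
    qed
    show ?thesis
    proof (cases "hd us = w \<and> last us = w")
      case False
      then show ?thesis using level ends by fastforce
    next
      case True
      \<comment> \<open>A distinct list with equal ends is a singleton; the block at
        \<open>w\<close> then has one vertex and forces \<xi> = 0.\<close>
      then have "p = 1" using hd_last_distinct us ne len by metis
      obtain B where B: "is_block G B" "w \<in> verts B" using vertex_in_block \<open>w \<in> verts G\<close> .
      then have "card (verts B) \<le> 1"
        using card_mono[OF finite_verts block_verts, of B] assms(2) \<open>p = 1\<close> by simp
      then show ?thesis using \<xi>[OF B] by simp
    qed
  qed
  ultimately show ?thesis using len by (simp add: mult.commute)
qed

end
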